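(* Let $p$ be a prime, let $k,r$ be positive integers with $k\ge 2$ and $r\le k$, let $h\ge r+2$ be an integer, and let $A$ be a $k$-element subset of $\mathbb{Z}_p$. If \[ |h^{(\geq r)}A| = h(k-1)-r(r-1)+1 \le p-2, \] then $A$ is an arithmetic progression in $\mathbb{Z}_p$.
   Context: $\mathbb{Z}_p=\{0,1,\ldots,p-1\}$ with addition modulo $p$. For a finite non-empty set $A=\{a_1,\ldots,a_k\}$ in an abelian group, a positive integer $r\le k$ and an integer $h\ge r$, define $h^{(\geq r)}A := \{ \sum_{i\in I} x_i a_i : I\subset\{1,\ldots,k\},\ |I|\ge r,\ x_i\ge 1 \text{ for all } i\in I,\ \sum_{i\in I}x_i = h\}$, i.e. the set of sums of $h$ elements of $A$ among which at least $r$ are distinct. *)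

theory Defs
  imports "HOL-Number_Theory.Residues"
begin

text \<open>Abelian groups are written additively, as the additive group of a \<^emph>\<open>ring\<close> record; the
  multiplication of the record plays no role.  The elements of \<^term>\<open>A\<close> are distinct, so an index
  set \<open>I \<subseteq> {1,\<dots>,k}\<close> is the same thing as a subset of \<^term>\<open>A\<close>.\<close>

definition distinct_sumset ::
    "('a, 'm) ring_scheme \<Rightarrow> nat \<Rightarrow> nat \<Rightarrow> 'a set \<Rightarrow> 'a set" where
  "distinct_sumset G h r A =
    {\<Oplus>\<^bsub>G\<^esub>a\<in>I. [x a] \<cdot>\<^bsub>G\<^esub> a | (I :: 'a set) (x :: 'a \<Rightarrow> nat).
       I \<subseteq> A \<and> card I \<ge> r \<and> (\<forall>a\<in>I. x a \<ge> 1) \<and> (\<Sum>a\<in>I. x a) = h}"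

text \<open>The number of terms is \<^term>\<open>card A\<close>, so the listed terms are pairwise distinct.\<close>

definition arith_progression :: "('a, 'm) ring_scheme \<Rightarrow> 'a set \<Rightarrow> bool" where
  "arith_progression G A \<longleftrightarrow>
    (\<exists>a\<in>carrier G. \<exists>d\<in>carrier G.
       A = {a \<oplus>\<^bsub>G\<^esub> [i] \<cdot>\<^bsub>G\<^esub> d | i :: nat. i < card A})"

end

theory Submission
  imports Defs "HOL-Library.Set_Algebras" "Jordan_Normal_Form.Determinant"
begin

text \<open>
  The sums of \<open>h\<close> elements of \<open>A\<close>, at least \<open>r\<close> of them distinct, form the sumset of the set \<open>r^A\<close> of
  sums of \<open>r\<close> distinct elements with \<open>h - r\<close> copies of \<open>A\<close>.  By the Dias da Silva--Hamidoune theorem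
  \<open>|r^A| \<ge> r(k - r) + 1\<close>, and by Cauchy--Davenport each further copy of \<open>A\<close> adds at least \<open>k - 1\<close>
  elements.  Equality at \<open>h\<close> therefore forces equality in the Cauchy--Davenport bound for the last
  copy of \<open>A\<close>; as \<open>h \<ge> r + 2\<close>, the other summand has at least two elements, and Vosper's theorem
  shows that \<open>A\<close> is a progression.

  A subset of \<open>\<int>/p\<close> is represented by its preimage in \<open>\<int>\<close>, a \<open>p\<close>-periodic set of integers, so that
  sumsets, translates and complements are those of \<open>\<int>\<close>.
\<close>

section \<open>Periodic sets of integers\<close>

locale prime_modulus =
  fixes p :: nat
  assumes prime_p: "prime p"
begin

definition periodic :: "int set \<Rightarrow> bool" where
  "periodic A \<longleftrightarrow> (\<forall>x\<in>A. \<forall>y. [x = y] (mod int p) \<longrightarrow> y \<in> A)"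

text \<open>For a periodic set this is the size of the corresponding subset of the integers modulo
  \<open>p\<close>, counted on the representatives from 0 to p - 1.\<close>

definition residue_count :: "int set \<Rightarrow> nat" where
  "residue_count A = card (A \<inter> {0..<int p})"

definition progression :: "int \<Rightarrow> int \<Rightarrow> nat \<Rightarrow> int set" where
  "progression d a n = {x. \<exists>i<n. [x = a + int i * d] (mod int p)}"

lemma p_gt_1: "p > 1"
  using prime_p prime_gt_1_nat by blast

lemma periodicD: "periodic A \<Longrightarrow> x \<in> A \<Longrightarrow> [x = y] (mod int p) \<Longrightarrow> y \<in> A"
  by (auto simp: periodic_def)

lemma periodic_mod_iff: "periodic A \<Longrightarrow> x mod int p \<in> A \<longleftrightarrow> x \<in> A"
  by (meson cong_mod_left cong_mod_right cong_refl periodicD)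

lemma periodic_Un: "periodic A \<Longrightarrow> periodic B \<Longrightarrow> periodic (A \<union> B)"
  and periodic_Int: "periodic A \<Longrightarrow> periodic B \<Longrightarrow> periodic (A \<inter> B)"
  by (auto simp: periodic_def)

lemma periodic_Compl: "periodic A \<Longrightarrow> periodic (- A)"
  unfolding periodic_def by (metis ComplD ComplI cong_sym)

lemma periodic_translate: "periodic A \<Longrightarrow> periodic {x. x + t \<in> A}"
  unfolding periodic_def using cong_add_rcancel[of _ t _ "int p"] by blast

lemma periodic_uminus: "periodic A \<Longrightarrow> periodic {x. - x \<in> A}"
  by (auto simp: periodic_def cong_minus_minus_iff)

lemma periodic_plus:
  assumes "periodic A"
  shows "periodic (A + B)"
  unfolding periodic_def
proof (intro ballI allI impI)
  fix x y assume "x \<in> A + B" and xy: "[x = y] (mod int p)"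
  then obtain a b where ab: "a \<in> A" "b \<in> B" "x = a + b" by (auto elim: set_plus_elim)
  have "[a = a + (y - x)] (mod int p)"
    using xy by (simp add: cong_iff_dvd_diff dvd_diff_commute)
  then have "a + (y - x) \<in> A" using assms ab periodicD by blast
  then have "(a + (y - x)) + b \<in> A + B" using ab by blast
  then show "y \<in> A + B" using ab by simp
qed

lemma periodic_progression: "periodic (progression d a n)"
  unfolding periodic_def progression_def by (auto dest: cong_sym intro: cong_trans)

lemma residue_count_mono: "A \<subseteq> B \<Longrightarrow> residue_count A \<le> residue_count B"
  unfolding residue_count_def by (intro card_mono) auto

lemma residue_count_le: "residue_count A \<le> p"
  using card_mono[of "{0..<int p}" "A \<inter> {0..<int p}"] by (simp add: residue_count_def)

lemma residue_count_UNIV [simp]: "residue_count UNIV = p"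
  by (simp add: residue_count_def)

lemma residue_count_empty [simp]: "residue_count {} = 0"
  by (simp add: residue_count_def)

lemma residue_count_Un_Int:
  "residue_count (A \<union> B) + residue_count (A \<inter> B) = residue_count A + residue_count B"
  using card_Un_Int[of "A \<inter> {0..<int p}" "B \<inter> {0..<int p}"]
  by (simp add: residue_count_def Int_Un_distrib2 Int_ac)

lemma residue_count_Compl: "residue_count (- A) = p - residue_count A"
  using residue_count_Un_Int[of A "- A"] by simp

lemma subset_residue_count_eq:
  assumes "periodic A" "periodic B" "A \<subseteq> B" "residue_count B \<le> residue_count A"
  shows "A = B"
proof -
  have "A \<inter> {0..<int p} = B \<inter> {0..<int p}"
    using assms card_seteq[of "B \<inter> {0..<int p}" "A \<inter> {0..<int p}"]
    unfolding residue_count_def by auto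
  moreover have "x mod int p \<in> {0..<int p}" for x using p_gt_1 by simp
  ultimately have "x mod int p \<in> A \<longleftrightarrow> x mod int p \<in> B" for x by blast
  then show ?thesis using assms by (auto simp: periodic_mod_iff)
qed

lemma residue_count_pos: "periodic A \<Longrightarrow> A \<noteq> {} \<Longrightarrow> residue_count A > 0"
  using subset_residue_count_eq[of "{}" A] by (force simp: periodic_def)

text \<open>A map that preserves and reflects congruence is injective on residues. Translation and
  negation are of this kind, and applying the bound to their inverses as well yields equality of
  counts.\<close>

lemma residue_count_vimage_le:
  assumes f: "\<And>x y. [f x = f y] (mod int p) \<longleftrightarrow> [x = y] (mod int p)"
    and A: "periodic A"
  shows "residue_count {x. f x \<in> A} \<le> residue_count A"
  unfolding residue_count_def
proof (rule card_inj_on_le[where f = "\<lambda>x. f x mod int p"])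
  show "inj_on (\<lambda>x. f x mod int p) ({x. f x \<in> A} \<inter> {0..<int p})"
  proof (rule inj_onI)
    fix x y assume xy: "x \<in> {x. f x \<in> A} \<inter> {0..<int p}" "y \<in> {x. f x \<in> A} \<inter> {0..<int p}"
      and "f x mod int p = f y mod int p"
    then have "[x = y] (mod int p)" using f by (simp add: cong_def)
    then show "x = y" using xy by (simp add: cong_def)
  qed
  show "(\<lambda>x. f x mod int p) ` ({x. f x \<in> A} \<inter> {0..<int p}) \<subseteq> A \<inter> {0..<int p}"
    using A p_gt_1 by (auto simp: periodic_mod_iff)
qed auto

lemma residue_count_translate:
  assumes "periodic A"
  shows "residue_count {x. x + t \<in> A} = residue_count A"
proof (rule antisym)
  show "residue_count {x. x + t \<in> A} \<le> residue_count A"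
    using assms by (intro residue_count_vimage_le) (auto simp: cong_add_rcancel)
  show "residue_count A \<le> residue_count {x. x + t \<in> A}"
    using residue_count_vimage_le[of "\<lambda>x. x + - t" "{x. x + t \<in> A}"] assms periodic_translate
    by (auto simp: cong_add_rcancel simp del: add_uminus_conv_diff)
qed

lemma residue_count_uminus:
  assumes "periodic A"
  shows "residue_count {x. - x \<in> A} = residue_count A"
proof (rule antisym)
  show "residue_count {x. - x \<in> A} \<le> residue_count A"
    using assms by (intro residue_count_vimage_le) (auto simp: cong_minus_minus_iff)
  show "residue_count A \<le> residue_count {x. - x \<in> A}"
    using residue_count_vimage_le[of uminus "{x. - x \<in> A}"] assms periodic_uminus
    by (auto simp: cong_minus_minus_iff)
qed

lemma residue_count_plus_ge:
  assumes "periodic A" "b \<in> B"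
  shows "residue_count A \<le> residue_count (A + B)"
proof -
  have "{x. x + - b \<in> A} \<subseteq> A + B"
    using assms(2) by (force intro: set_plus_intro dest: set_plus_intro)
  then show ?thesis
    using residue_count_mono residue_count_translate[OF assms(1)] by metis
qed

section \<open>Arithmetic progressions modulo a prime\<close>

lemma coprime_p: "\<not> int p dvd d \<Longrightarrow> coprime d (int p)"
  using prime_imp_coprime[of "int p" d] prime_p by (simp add: coprime_commute)

text \<open>As \<open>p\<close> is prime, \<open>d\<close> has an inverse \<open>e\<close> modulo
  \<open>p\<close>, and \<open>i\<close> is the residue of \<open>(x - a) * e\<close>. Thus the
  progression from \<open>a\<close> with difference \<open>d\<close> runs through all
  residues.\<close>

lemma progression_coordinate:
  assumes "\<not> int p dvd d"
  obtains i where "i < p" "[x = a + int i * d] (mod int p)"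
proof -
  obtain e where e: "[d * e = 1] (mod int p)"
    using coprime_p[OF assms] cong_solve_coprime_int by blast
  define i where "i = nat (((x - a) * e) mod int p)"
  have i: "int i = ((x - a) * e) mod int p" using p_gt_1 by (simp add: i_def)
  have "[int i * d = (x - a) * e * d] (mod int p)" unfolding i by (simp add: cong_def mod_mult_left_eq)
  also have "(x - a) * e * d = (x - a) * (d * e)" by simp
  also have "[(x - a) * (d * e) = (x - a) * 1] (mod int p)" by (rule cong_mult[OF cong_refl e])
  finally have "[a + int i * d = a + (x - a)] (mod int p)" by (intro cong_add) auto
  then have "[x = a + int i * d] (mod int p)" by (simp add: cong_sym_eq)
  moreover have "i < p" using p_gt_1 by (simp add: i_def nat_less_iff)
  ultimately show ?thesis using that by blast
qed

lemma progression_coordinate_unique: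
  assumes "\<not> int p dvd d" "i < p" "j < p" "[a + int i * d = a + int j * d] (mod int p)"
  shows "i = j"
proof -
  have "[int i * d = int j * d] (mod int p)" using assms(4) by (simp add: cong_add_lcancel)
  then have "[int i = int j] (mod int p)"
    using cong_mult_rcancel coprime_p[OF assms(1)] by blast
  then show ?thesis using assms by (simp add: cong_def)
qed

lemma residue_count_progression:
  assumes "\<not> int p dvd d" "n \<le> p"
  shows "residue_count (progression d a n) = n"
proof -
  define f where "f i = (a + int i * d) mod int p" for i
  have "progression d a n \<inter> {0..<int p} = f ` {..<n}"
    using p_gt_1 by (auto simp: progression_def f_def cong_def)
  moreover have "inj_on f {..<n}"
    using assms progression_coordinate_unique[OF assms(1)]
    by (auto simp: inj_on_def f_def cong_def)
  ultimately show ?thesis by (simp add: residue_count_def card_image)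
qed

text \<open>The first \<open>p\<close> terms of the progression exhaust all residues, so the
  complement consists of the remaining \<open>p - n\<close> terms. Disjointness together with
  equality of counts proves it.\<close>

lemma Compl_progression:
  assumes "\<not> int p dvd d" "n \<le> p"
  shows "- progression d a n = progression d (a + int n * d) (p - n)"
proof (rule sym, rule subset_residue_count_eq)
  show "progression d (a + int n * d) (p - n) \<subseteq> - progression d a n"
  proof clarify
    fix x assume "x \<in> progression d (a + int n * d) (p - n)" "x \<in> progression d a n"
    then obtain i j where i: "i < p - n" "[x = a + int n * d + int i * d] (mod int p)"
      and j: "j < n" "[x = a + int j * d] (mod int p)" by (auto simp: progression_def)
    have "[a + int (n + i) * d = a + int j * d] (mod int p)"
      using cong_trans[OF cong_sym[OF i(2)] j(2)] by (simp add: algebra_simps)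
    with i(1) j(1) assms(2) have "n + i = j"
      by (intro progression_coordinate_unique[OF assms(1)]) auto
    with j(1) show False by simp
  qed
qed (use assms in \<open>auto simp: residue_count_Compl residue_count_progression
      intro: periodic_Compl periodic_progression\<close>)

lemma uminus_progression: "{x. - x \<in> progression d a n} = progression (- d) (- a) n"
proof -
  have "[- x = a + int i * d] (mod int p) \<longleftrightarrow> [x = - a + int i * - d] (mod int p)" for x i
    using cong_minus_minus_iff[of "- x" "a + int i * d" "int p"] by simp
  then show ?thesis by (simp add: progression_def)
qed

lemma progression_uminus:
  assumes "n > 0"
  shows "progression (- d) a n = progression d (a - int (n - 1) * d) n"
proof -
  have eq: "a + int i * - d = a - int (n - 1) * d + int (n - 1 - i) * d" if "i < n" for i
    using that by (simp add: of_nat_diff algebra_simps)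
  show ?thesis
  proof (rule Set.set_eqI)
    fix x
    have "(\<exists>i<n. [x = a + int i * - d] (mod int p)) \<longleftrightarrow>
      (\<exists>i<n. [x = a - int (n - 1) * d + int (n - 1 - i) * d] (mod int p))"
      using eq by (metis (no_types, lifting))
    also have "\<dots> \<longleftrightarrow> (\<exists>i<n. [x = a - int (n - 1) * d + int i * d] (mod int p))"
    proof
      assume "\<exists>i<n. [x = a - int (n - 1) * d + int (n - 1 - i) * d] (mod int p)"
      then obtain i where "i < n" "[x = a - int (n - 1) * d + int (n - 1 - i) * d] (mod int p)" by blast
      then show "\<exists>i<n. [x = a - int (n - 1) * d + int i * d] (mod int p)"
        by (intro exI[of _ "n - 1 - i"]) auto
    next
      assume "\<exists>i<n. [x = a - int (n - 1) * d + int i * d] (mod int p)"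
      then obtain i where "i < n" "[x = a - int (n - 1) * d + int i * d] (mod int p)" by blast
      moreover have "n - 1 - (n - 1 - i) = i" using \<open>i < n\<close> by simp
      ultimately show "\<exists>i<n. [x = a - int (n - 1) * d + int (n - 1 - i) * d] (mod int p)"
        by (intro exI[of _ "n - 1 - i"]) auto
    qed
    finally show "x \<in> progression (- d) a n \<longleftrightarrow> x \<in> progression d (a - int (n - 1) * d) n"
      by (simp add: progression_def)
  qed
qed

lemma progression_plus:
  assumes "m > 0" "n > 0"
  shows "progression d a m + progression d b n = progression d (a + b) (m + n - 1)"
proof (intro equalityI subsetI)
  fix x assume "x \<in> progression d a m + progression d b n"
  then obtain u v i j where "x = u + v" "i < m" "j < n"
    "[u = a + int i * d] (mod int p)" "[v = b + int j * d] (mod int p)"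
    by (auto simp: progression_def elim!: set_plus_elim)
  then have "[x = (a + b) + int (i + j) * d] (mod int p)" "i + j < m + n - 1"
    using cong_add[of u "a + int i * d" "int p" v "b + int j * d"] by (auto simp: algebra_simps)
  then show "x \<in> progression d (a + b) (m + n - 1)" unfolding progression_def by blast
next
  fix x assume "x \<in> progression d (a + b) (m + n - 1)"
  then obtain i where i: "i < m + n - 1" "[x = a + b + int i * d] (mod int p)"
    by (auto simp: progression_def)
  obtain k l where kl: "k < m" "l < n" "i = k + l"
  proof (cases "i < m")
    case True then show ?thesis using that[of i 0] assms by simp
  next
    case False then show ?thesis using that[of "m - 1" "i - (m - 1)"] i(1) assms by auto
  qed
  define u where "u = a + int k * d"
  have "[x - u = b + int l * d] (mod int p)"
    using cong_diff[OF i(2) cong_refl[of u]] by (simp add: u_def kl algebra_simps)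
  then have "x - u \<in> progression d b n" using kl by (auto simp: progression_def)
  moreover have "u \<in> progression d a m" using kl by (auto simp: progression_def u_def)
  ultimately have "u + (x - u) \<in> progression d a m + progression d b n" by (rule set_plus_intro[rotated])
  then show "x \<in> progression d a m + progression d b n" by simp
qed

text \<open>Repeated steps by \<open>d\<close> reach every residue. The lemma is mostly used in
  contrapositive form: a proper nonempty periodic set has an element that a step by \<open>d\<close>
  takes out of it.\<close>

lemma translation_closed_UNIV:
  assumes "periodic A" "A \<noteq> {}" "\<not> int p dvd d" "\<And>x. x \<in> A \<Longrightarrow> x + d \<in> A"
  shows "A = UNIV"
proof -
  obtain a where "a \<in> A" using assms by blast
  then have mem: "a + int n * d \<in> A" for n
    by (induction n) (use assms(4) in \<open>force simp: algebra_simps\<close>)+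
  have "x \<in> A" for x
    by (rule progression_coordinate[OF assms(3), of x a])
      (use periodicD[OF assms(1) mem] cong_sym in blast)
  then show ?thesis by blast
qed

text \<open>Otherwise \<open>B\<close> would lie in the single residue class of \<open>b\<close>,
  which is written as the one-term progression \<open>progression 1 b 1\<close>.\<close>

lemma two_residues:
  assumes "periodic B" "residue_count B \<ge> 2" "b \<in> B"
  obtains c where "c \<in> B" "\<not> int p dvd c - b"
proof (rule ccontr)
  assume "\<not> thesis"
  then have "B \<subseteq> progression 1 b 1"
    using that by (auto simp: progression_def cong_iff_dvd_diff)
  then have "residue_count B \<le> residue_count (progression 1 b 1)" by (rule residue_count_mono)
  also have "\<dots> = 1" using p_gt_1 by (intro residue_count_progression) auto
  finally show False using assms by simp
qed


section \<open>The theorems of Cauchy--Davenport and Vosper\<close>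

text \<open>In terms of translates, \<open>A' e\<close> is the union of A with B + e, and
  \<open>B' e\<close> is the intersection of B with A - e. The total count is preserved because
  \<open>B' e\<close> is a translate of the intersection of A with B + e. The sumset does not grow
  because a sum of x in B + e and y in A - e regroups as \<open>(y + e) + (x - e)\<close>.\<close>

lemma dyson_transform:
  assumes A: "periodic A" and B: "periodic B"
  defines "A' e \<equiv> A \<union> {x. x + - e \<in> B}" and "B' e \<equiv> B \<inter> {x. x + e \<in> A}"
  shows "periodic (A' e)" and "periodic (B' e)"
    and "A' e + B' e \<subseteq> A + B"
    and "residue_count (A' e) + residue_count (B' e) = residue_count A + residue_count B"
proof -
  show "periodic (A' e)" "periodic (B' e)"
    unfolding A'_def B'_def
    using A B by (auto intro!: periodic_Un periodic_Int periodic_translate simp del: add_uminus_conv_diff)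
  show "A' e + B' e \<subseteq> A + B"
  proof
    fix z assume "z \<in> A' e + B' e"
    then obtain x y where xy: "z = x + y" "x \<in> A' e" "y \<in> B" "y + e \<in> A"
      by (auto simp: B'_def elim!: set_plus_elim)
    show "z \<in> A + B"
    proof (cases "x \<in> A")
      case True
      then show ?thesis using xy by blast
    next
      case False
      then have "x - e \<in> B" using xy by (simp add: A'_def)
      then have "(y + e) + (x - e) \<in> A + B" using xy by blast
      then show ?thesis by (simp add: xy add.commute)
    qed
  qed
  have "B' e = {x. x + e \<in> A \<inter> {x. x + - e \<in> B}}" by (auto simp: B'_def)
  moreover have "periodic (A \<inter> {x. x + - e \<in> B})" using A B periodic_Int periodic_translate by blast
  ultimately have "residue_count (B' e) = residue_count (A \<inter> {x. x + - e \<in> B})"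
    by (simp only: residue_count_translate)
  moreover have "residue_count {x. x + - e \<in> B} = residue_count B"
    using B by (rule residue_count_translate)
  ultimately show "residue_count (A' e) + residue_count (B' e) = residue_count A + residue_count B"
    unfolding A'_def by (simp add: residue_count_Un_Int del: add_uminus_conv_diff)
qed

text \<open>Induction on the size of \<open>B\<close>: a Dyson transform that strictly shrinks
  \<open>B\<close> but leaves it nonempty keeps the sum of the sizes and only shrinks the
  sumset.\<close>

theorem cauchy_davenport:
  assumes "periodic A" "periodic B" "A \<noteq> {}" "B \<noteq> {}"
  shows "min p (residue_count A + residue_count B - 1) \<le> residue_count (A + B)"
  using assms
proof (induction "residue_count B" arbitrary: A B rule: less_induct)
  case less
  obtain b where b: "b \<in> B" using less.prems by blast
  consider "residue_count B \<le> 1" | "A = UNIV" | "residue_count B \<ge> 2" "A \<noteq> UNIV" by linarith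
  then show ?case
  proof cases
    case 1
    then show ?thesis using residue_count_plus_ge[OF less.prems(1) b] by simp
  next
    case 2
    then show ?thesis using residue_count_plus_ge[OF less.prems(1) b] by simp
  next
    case 3
    then obtain c where c: "c \<in> B" "\<not> int p dvd c - b" using two_residues b less.prems by blast
    then obtain a where a: "a \<in> A" "a + (c - b) \<notin> A"
      using translation_closed_UNIV 3 less.prems by blast
    \<comment> \<open>With this shift \<open>b + e = a\<close> lies in \<open>A\<close>, while
      \<open>c + e = a + (c - b)\<close> does not, so the transform keeps \<open>b\<close> and
      discards \<open>c\<close>.\<close>
    define e where "e = a - b"
    define A' where "A' = A \<union> {x. x + - e \<in> B}"
    define B' where "B' = B \<inter> {x. x + e \<in> A}"
    note T = dyson_transform[OF less.prems(1,2), of e, folded A'_def B'_def]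
    have "b \<in> B'" using a b by (simp add: B'_def e_def)
    have "c \<notin> B'" using a by (simp add: B'_def e_def algebra_simps)
    then have "B' \<noteq> B" "B' \<subseteq> B" using c by (auto simp: B'_def)
    then have "residue_count B' < residue_count B"
      using subset_residue_count_eq[OF T(2) less.prems(2)] not_le by blast
    moreover have "A' \<noteq> {}" "B' \<noteq> {}" using a \<open>b \<in> B'\<close> by (auto simp: A'_def)
    ultimately have "min p (residue_count A' + residue_count B' - 1) \<le> residue_count (A' + B')"
      using less.hyps T by blast
    then show ?thesis using residue_count_mono[OF T(3)] T(4) by linarith
  qed
qed

text \<open>A proper nonempty set splits into maximal runs with step \<open>d\<close>, and each run
  contributes one new residue, its exit, to the translate of \<open>B\<close> by \<open>d\<close>.
  At most one new residue means a single run.\<close>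

lemma progression_of_near_invariant:
  assumes B: "periodic B" "B \<noteq> {}" "B \<noteq> UNIV" and d: "\<not> int p dvd d"
    and near: "residue_count (B \<union> {x. x + - d \<in> B}) \<le> residue_count B + 1"
  shows "\<exists>b. B = progression d b (residue_count B)"
proof -
  \<comment> \<open>Here \<open>x\<close> and \<open>y\<close> are exits from \<open>B\<close>. If
    they were incongruent, the two-term progression through them would add two residues to
    \<open>B\<close>.\<close>
  have unique: "[x = y] (mod int p)" if "x - d \<in> B" "x \<notin> B" "y - d \<in> B" "y \<notin> B" for x y
  proof (rule ccontr)
    assume "\<not> ?thesis"
    then have nd: "\<not> int p dvd y - x" by (simp add: cong_iff_dvd_diff dvd_diff_commute)
    let ?P = "progression (y - x) x 2"
    have "?P \<inter> B = {}"
    proof -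
      have "z \<notin> B" if "z \<in> ?P" for z
      proof
        assume "z \<in> B"
        from that obtain i where "i < 2" "[z = x + int i * (y - x)] (mod int p)"
          by (auto simp: progression_def)
        then have "[z = x] (mod int p) \<or> [z = y] (mod int p)" by (auto simp: less_2_cases_iff)
        then show False using periodicD[OF B(1) \<open>z \<in> B\<close>] \<open>x \<notin> B\<close> \<open>y \<notin> B\<close> by blast
      qed
      then show ?thesis by blast
    qed
    moreover have "?P \<subseteq> {x. x + - d \<in> B}"
    proof
      fix z assume "z \<in> ?P"
      then obtain i where "i < 2" "[z = x + int i * (y - x)] (mod int p)"
        by (auto simp: progression_def)
      then have "[z = x] (mod int p) \<or> [z = y] (mod int p)" by (auto simp: less_2_cases_iff)
      then have "[x - d = z - d] (mod int p) \<or> [y - d = z - d] (mod int p)"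
        by (meson cong_diff cong_refl cong_sym)
      then show "z \<in> {x. x + - d \<in> B}" using periodicD[OF B(1)] that by auto
    qed
    then have "B \<union> ?P \<subseteq> B \<union> {x. x + - d \<in> B}" by blast
    then have "residue_count (B \<union> ?P) \<le> residue_count B + 1" using near residue_count_mono le_trans by blast
    moreover have "residue_count ?P = 2" using nd p_gt_1 by (intro residue_count_progression) auto
    ultimately show False using residue_count_Un_Int[of B ?P] by (simp add: Int_commute)
  qed
  have "\<not> int p dvd - d" using d by simp
  \<comment> \<open>\<open>s\<close> is the first element of a run, since its predecessor lies
    outside \<open>B\<close>; below, \<open>m\<close> is the length of that run, up to its first
    exit.\<close>
  then obtain s where s: "s \<in> B" "s - d \<notin> B"
    using translation_closed_UNIV[OF B(1,2), of "- d"] B(3) by auto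
  obtain x where x: "x \<notin> B" using B by blast
  obtain i where i: "i < p" "[x = s + int i * d] (mod int p)" using progression_coordinate[OF d] .
  have "s + int i * d \<notin> B" using x i periodicD[OF B(1)] cong_sym by blast
  define m where "m = (LEAST m. s + int m * d \<notin> B)"
  have mB: "s + int m * d \<notin> B" and "m \<le> i"
    using \<open>s + int i * d \<notin> B\<close> unfolding m_def by (rule LeastI, rule Least_le)
  have less_m: "s + int j * d \<in> B" if "j < m" for j using not_less_Least that m_def by blast
  have "m > 0" using mB s by (cases m) auto
  let ?P = "progression d s m"
  have "?P \<subseteq> B" using less_m periodicD[OF B(1)] cong_sym by (force simp: progression_def)
  \<comment> \<open>The rest of \<open>B\<close> would be closed under steps by \<open>d\<close>: by
    \<open>unique\<close> the only way out of \<open>B\<close> is through the last term of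
    \<open>?P\<close>, and a step into \<open>?P\<close> from outside would have to start at the
    residue of \<open>s - d\<close>, which is not in \<open>B\<close>. Closure would make
    \<open>B\<close> everything.\<close>
  have "B \<inter> - ?P = {}"
  proof (rule ccontr)
    assume ne: "B \<inter> - ?P \<noteq> {}"
    have "B \<inter> - ?P = UNIV"
    proof (rule translation_closed_UNIV[OF _ ne d])
      show "periodic (B \<inter> - ?P)" using B periodic_Int periodic_Compl periodic_progression by blast
      fix x assume x: "x \<in> B \<inter> - ?P"
      have "x + d \<in> B"
      proof (rule ccontr)
        assume "x + d \<notin> B"
        have "s + int m * d - d \<in> B" using less_m[of "m - 1"] \<open>m > 0\<close> by (simp add: of_nat_diff algebra_simps)
        then have "[x + d = s + int m * d] (mod int p)"
          using unique[of "x + d" "s + int m * d"] x mB \<open>x + d \<notin> B\<close> by simp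
        then have "[x = s + int (m - 1) * d] (mod int p)"
          using cong_diff[OF _ cong_refl[of d], of "x + d" "s + int m * d"] \<open>m > 0\<close>
          by (simp add: of_nat_diff algebra_simps)
        then have "x \<in> ?P" using \<open>m > 0\<close> by (auto simp: progression_def intro!: exI[of _ "m - 1"])
        then show False using x by blast
      qed
      moreover have "x + d \<notin> ?P"
      proof
        assume "x + d \<in> ?P"
        then obtain j where j: "j < m" "[x + d = s + int j * d] (mod int p)" by (auto simp: progression_def)
        have eq: "[x = s + int j * d - d] (mod int p)" using cong_diff[OF j(2) cong_refl[of d]] by simp
        show False
        proof (cases j)
          case 0
          then show False using eq x s periodicD[OF B(1), of x "s - d"] by simp
        next
          case (Suc l)
          then have "[x = s + int l * d] (mod int p)" using eq by (simp add: algebra_simps)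
          then show False using x j(1) Suc by (auto simp: progression_def)
        qed
      qed
      ultimately show "x + d \<in> B \<inter> - ?P" by blast
    qed
    then show False using B(3) by blast
  qed
  then have "B = ?P" using \<open>?P \<subseteq> B\<close> by blast
  moreover have "residue_count ?P = m" using d \<open>m \<le> i\<close> i by (intro residue_count_progression) auto
  ultimately show ?thesis by metis
qed

text \<open>Split the progression as one with \<open>n - 1\<close> terms plus the classes of 0 and
  \<open>d\<close>. Cauchy--Davenport for the shorter progression and \<open>B + ?Q\<close> leaves
  room for only one new residue in \<open>B + ?Q\<close>; \<open>bound\<close> ensures that the
  minimum there is not \<open>p\<close>.\<close>

lemma critical_progression:
  assumes d: "\<not> int p dvd d" and n: "2 \<le> n" and B: "periodic B" "B \<noteq> {}"
    and crit: "residue_count (progression d a n + B) + 1 \<le> n + residue_count B"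
    and bound: "n + residue_count B \<le> p"
  shows "\<exists>b. B = progression d b (residue_count B)"
proof (rule progression_of_near_invariant[OF B _ d])
  let ?Q = "progression d 0 2" and ?R = "progression d a (n - 1)"
  have "a \<in> ?R" using n by (auto simp: progression_def intro!: exI[of _ 0])
  then have "?R \<noteq> {}" by blast
  have Q: "0 \<in> ?Q" "d \<in> ?Q"
    by (auto simp: progression_def intro: exI[of _ "0::nat"] exI[of _ "1::nat"])
  have "progression d a n = ?R + ?Q" using n by (simp add: progression_plus)
  then have eq: "progression d a n + B = (B + ?Q) + ?R" by (simp add: ac_simps)
  have "B + ?Q \<noteq> {}" using B Q by blast
  then have "min p (residue_count (B + ?Q) + (n - 1) - 1) \<le> residue_count (progression d a n + B)"
    using cauchy_davenport[of "B + ?Q" ?R] B \<open>?R \<noteq> {}\<close> bound n d residue_count_progression[of d "n - 1" a]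
    by (simp add: eq periodic_plus periodic_progression)
  then have "residue_count (B + ?Q) \<le> residue_count B + 1" using crit bound n by linarith
  moreover have "B \<union> {x. x + - d \<in> B} \<subseteq> B + ?Q"
  proof
    fix x assume "x \<in> B \<union> {x. x + - d \<in> B}"
    then consider "x \<in> B" | "x - d \<in> B" by (metis UnE mem_Collect_eq add_uminus_conv_diff)
    then show "x \<in> B + ?Q"
    proof cases
      case 1
      then have "x + 0 \<in> B + ?Q" using Q(1) by (rule set_plus_intro)
      then show ?thesis by simp
    next
      case 2
      then have "(x - d) + d \<in> B + ?Q" using Q(2) by (rule set_plus_intro)
      then show ?thesis by simp
    qed
  qed
  ultimately show "residue_count (B \<union> {x. x + - d \<in> B}) \<le> residue_count B + 1"
    using residue_count_mono le_trans by blast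
  show "B \<noteq> UNIV" using bound n by auto
qed

text \<open>Passes from the sumset back to the summands at the end of the induction for Vosper's
  theorem: \<open>A\<close> is obtained by duality from the complement of the sumset, and then
  \<open>B\<close> from \<open>A\<close> by \<open>critical_progression\<close>.\<close>

lemma critical_sum_progression:
  assumes d: "\<not> int p dvd d" and A: "periodic A" "2 \<le> residue_count A" and B: "periodic B" "B \<noteq> {}"
    and sum: "A + B = progression d s n" "n \<le> p"
    and crit: "n + 1 \<le> residue_count A + residue_count B"
    and bound: "residue_count A + residue_count B + 1 \<le> p"
  shows "\<exists>a b. A = progression d a (residue_count A) \<and> B = progression d b (residue_count B)"
proof -
  have A_ne: "A \<noteq> {}" using A by auto
  have count: "residue_count (A + B) = n" using sum d residue_count_progression by simp
  then have n: "n + 1 = residue_count A + residue_count B"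
    using cauchy_davenport[OF A(1) B(1) A_ne B(2)] crit bound by simp
  \<comment> \<open>\<open>(?C, A)\<close> is again a critical pair, and \<open>?C\<close> is a progression because \<open>A + B\<close> is.\<close>
  let ?C = "{x. - x \<in> - (A + B)}"
  have C: "?C = progression (- d) (- (s + int n * d)) (p - n)"
    unfolding sum Compl_progression[OF d sum(2)] by (rule uminus_progression)
  \<comment> \<open>If \<open>x = c + a\<close> had \<open>- x\<close> in \<open>B\<close>, then
    \<open>- c = a + (- x)\<close> would lie in \<open>A + B\<close>.\<close>
  have "?C + A \<subseteq> {x. - x \<in> - B}"
  proof
    fix x assume "x \<in> ?C + A"
    then obtain c a where ca: "x = c + a" "- c \<notin> A + B" "a \<in> A" by (auto elim!: set_plus_elim)
    have "- x \<notin> B" using set_plus_intro[OF ca(3), of "- x" B] ca by auto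
    then show "x \<in> {x. - x \<in> - B}" by simp
  qed
  then have "residue_count (?C + A) \<le> p - residue_count B"
    using residue_count_mono residue_count_uminus[OF periodic_Compl[OF B(1)]] residue_count_Compl by metis
  then have "residue_count (progression (- d) (- (s + int n * d)) (p - n) + A) + 1
      \<le> (p - n) + residue_count A"
    using n bound unfolding C by simp
  moreover have "\<not> int p dvd - d" using d by simp
  \<comment> \<open>The size conditions hold because \<open>bound\<close> gives
    \<open>n + 2 \<le> p\<close>, and \<open>B\<close> being nonempty gives
    \<open>residue_count A \<le> n\<close>.\<close>
  ultimately obtain a where "A = progression (- d) a (residue_count A)"
    using critical_progression[of "- d" "p - n" A] n bound A A_ne residue_count_pos[OF B] by fastforce
  then obtain a' where a': "A = progression d a' (residue_count A)"
    using progression_uminus[of "residue_count A" d a] A(2) by auto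
  have "residue_count (progression d a' (residue_count A) + B) + 1 \<le> residue_count A + residue_count B"
    using count n a' by simp
  then show ?thesis using critical_progression[OF d A(2) B] bound a' by (metis add_leD1)
qed

text \<open>Induction on the size of \<open>B\<close>. A two-element \<open>B\<close> is itself a
  progression, so \<open>critical_progression\<close> applies. Otherwise a suitable Dyson transform
  is again a critical pair, its sumset is a progression by induction, and this sumset turns out to
  be \<open>A + B\<close>.\<close>

theorem vosper:
  assumes "periodic A" "periodic B" "2 \<le> residue_count A" "2 \<le> residue_count B"
    and "residue_count (A + B) + 1 \<le> residue_count A + residue_count B"
    and "residue_count A + residue_count B + 1 \<le> p"
  shows "\<exists>d a b. \<not> int p dvd d \<and> A = progression d a (residue_count A) \<and>
    B = progression d b (residue_count B)"
  using assms
proof (induction "residue_count B" arbitrary: A B rule: less_induct)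
  case less
  note A = less.prems(1,3) and B = less.prems(2,4) and crit = less.prems(5) and bound = less.prems(6)
  have A_ne: "A \<noteq> {}" and B_ne: "B \<noteq> {}" using A B by auto
  have pair: "residue_count (progression (c - b) b 2) = 2 \<and> progression (c - b) b 2 \<subseteq> D"
    if "periodic D" "b \<in> D" "c \<in> D" "\<not> int p dvd c - b" for b c D
  proof
    show "residue_count (progression (c - b) b 2) = 2"
      using that p_gt_1 by (intro residue_count_progression) auto
    show "progression (c - b) b 2 \<subseteq> D"
    proof
      fix z assume "z \<in> progression (c - b) b 2"
      then obtain i where "i < 2" "[z = b + int i * (c - b)] (mod int p)"
        by (auto simp: progression_def)
      then have "[b = z] (mod int p) \<or> [c = z] (mod int p)" by (auto simp: less_2_cases_iff cong_sym_eq)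
      then show "z \<in> D" using periodicD[OF that(1)] that by auto
    qed
  qed
  obtain b0 where b0: "b0 \<in> B" using B_ne by blast
  show ?case
  proof (cases "residue_count B = 2")
    case True
    obtain c where c: "c \<in> B" "\<not> int p dvd c - b0" using two_residues[OF B b0] .
    then have Beq: "progression (c - b0) b0 2 = B"
      using pair[OF B(1) b0] True by (intro subset_residue_count_eq periodic_progression B) auto
    have "residue_count (progression (c - b0) b0 2 + A) + 1 \<le> 2 + residue_count A"
      using crit True Beq by (simp add: add.commute)
    then have "\<exists>a. A = progression (c - b0) a (residue_count A)"
      using critical_progression[OF c(2) order_refl A(1) A_ne] bound True by simp
    then show ?thesis using c Beq True by metis
  next
    case False
    then have B3: "residue_count B \<ge> 3" using B by simp
    \<comment> \<open>There is a Dyson transform shrinking \<open>B\<close> to a proper subset with at least two elements.\<close>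
    have "\<exists>e b c. B \<inter> {x. x + e \<in> A} \<noteq> B \<and> b \<in> B \<inter> {x. x + e \<in> A} \<and>
      c \<in> B \<inter> {x. x + e \<in> A} \<and> \<not> int p dvd c - b"
    proof (rule ccontr)
      assume "\<not> ?thesis"
      then have small: "B \<inter> {x. x + e \<in> A} = B \<or> int p dvd c - b"
        if "b \<in> B \<inter> {x. x + e \<in> A}" "c \<in> B \<inter> {x. x + e \<in> A}" for e b c using that by blast
      \<comment> \<open>\<open>Y\<close> collects those \<open>a\<close> for which the shift
        \<open>a - b0\<close> keeps all of \<open>B\<close>. For \<open>x\<close> in
        \<open>X\<close> the shift \<open>x - b0\<close> does not, so by \<open>small\<close> it
        keeps only the class of \<open>b0\<close>. Hence \<open>X + B'\<close> avoids the translate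
        of \<open>A\<close> by \<open>b0\<close> inside \<open>A + B\<close>, which leaves at most
        |B| - 1 residues, whereas Cauchy--Davenport demands at least |B|.\<close>
      define Y where "Y = {a \<in> A. \<forall>b\<in>B. a + (b - b0) \<in> A}"
      define X where "X = A \<inter> - Y"
      define B' where "B' = B \<inter> - progression 1 b0 1"
      have A0: "periodic {x. x + - b0 \<in> A}" "residue_count {x. x + - b0 \<in> A} = residue_count A"
        using A periodic_translate residue_count_translate by blast+
      have "periodic Y"
        unfolding periodic_def
      proof (intro ballI allI impI)
        fix x y assume "x \<in> Y" and xy: "[x = y] (mod int p)"
        have "[x + t = y + t] (mod int p)" for t using xy by (simp add: cong_add_rcancel)
        then show "y \<in> Y" using \<open>x \<in> Y\<close> xy periodicD[OF A(1)] unfolding Y_def by blast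
      qed
      have "periodic X" using \<open>periodic Y\<close> A periodic_Int periodic_Compl X_def by blast
      have "periodic B'" using B periodic_Int periodic_Compl periodic_progression B'_def by blast
      have countX: "residue_count X + residue_count Y = residue_count A"
      proof -
        have "X \<union> Y = A" "X \<inter> Y = {}" by (auto simp: X_def Y_def)
        then show ?thesis using residue_count_Un_Int[of X Y] by simp
      qed
      have "progression 1 b0 1 \<subseteq> B"
        using b0 periodicD[OF B(1)] cong_sym by (fastforce simp: progression_def)
      then have "B' \<union> progression 1 b0 1 = B" "B' \<inter> progression 1 b0 1 = {}" by (auto simp: B'_def)
      moreover have "residue_count (progression 1 b0 1) = 1"
        using p_gt_1 by (intro residue_count_progression) auto
      ultimately have countB': "residue_count B' + 1 = residue_count B"
        using residue_count_Un_Int[of B' "progression 1 b0 1"] by simp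
      \<comment> \<open>\<open>Y + B\<close> fits into a translate of \<open>A\<close>, so
        Cauchy--Davenport gives |Y| + |B| - 1 \<le> |A| and thus |X| \<ge> |B| - 1 \<ge> 2 for
        nonempty \<open>Y\<close>.\<close>
      have "residue_count X \<ge> 2"
      proof (cases "Y = {}")
        case True
        then show ?thesis using countX A by simp
      next
        case False
        have "Y + B \<subseteq> {x. x + - b0 \<in> A}"
          by (auto simp: Y_def algebra_simps elim!: set_plus_elim)
        then have "residue_count (Y + B) \<le> residue_count A" using A0 residue_count_mono by metis
        then have "residue_count Y + residue_count B - 1 \<le> residue_count A"
          using cauchy_davenport[OF \<open>periodic Y\<close> B(1) False B_ne] bound by linarith
        then show ?thesis using countX B3 by linarith
      qed
      have "X + B' \<subseteq> (A + B) \<inter> - {x. x + - b0 \<in> A}"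
      proof
        fix z assume "z \<in> X + B'"
        then obtain x b where xb: "z = x + b" "x \<in> X" "b \<in> B'" by (auto elim!: set_plus_elim)
        then have "x \<in> A" "b \<in> B" by (auto simp: X_def B'_def)
        obtain b1 where b1: "b1 \<in> B" "x + (b1 - b0) \<notin> A" using xb by (auto simp: X_def Y_def)
        have "x + (b - b0) \<notin> A"
        proof
          assume "x + (b - b0) \<in> A"
          then have "b \<in> B \<inter> {y. y + (x - b0) \<in> A}" "b0 \<in> B \<inter> {y. y + (x - b0) \<in> A}"
            using \<open>b \<in> B\<close> \<open>x \<in> A\<close> b0 by (auto simp: algebra_simps)
          moreover have "b1 \<notin> B \<inter> {y. y + (x - b0) \<in> A}" using b1 by (auto simp: algebra_simps)
          ultimately have "int p dvd b - b0" using small[of b0 "x - b0" b] b1 by blast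
          then show False using xb(3) by (auto simp: B'_def progression_def cong_iff_dvd_diff)
        qed
        moreover have "z + - b0 = x + (b - b0)" by (simp add: xb(1))
        ultimately have "z + - b0 \<notin> A" by metis
        moreover have "z \<in> A + B" unfolding xb(1) using \<open>x \<in> A\<close> \<open>b \<in> B\<close> by (rule set_plus_intro)
        ultimately show "z \<in> (A + B) \<inter> - {x. x + - b0 \<in> A}" by simp
      qed
      moreover have "residue_count ((A + B) \<inter> - {x. x + - b0 \<in> A}) + residue_count A = residue_count (A + B)"
      proof -
        have "{x. x + - b0 \<in> A} \<subseteq> A + B" using b0 set_plus_intro[of _ A b0 B] by force
        then have "(A + B) \<inter> - {x. x + - b0 \<in> A} \<union> {x. x + - b0 \<in> A} = A + B" by blast
        moreover have "(A + B) \<inter> - {x. x + - b0 \<in> A} \<inter> {x. x + - b0 \<in> A} = {}" by blast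
        ultimately show ?thesis
          using residue_count_Un_Int[of "(A + B) \<inter> - {x. x + - b0 \<in> A}" "{x. x + - b0 \<in> A}"] A0 by simp
      qed
      ultimately have "residue_count (X + B') + 1 \<le> residue_count B"
        using crit residue_count_mono[of "X + B'" "(A + B) \<inter> - {x. x + - b0 \<in> A}"] by linarith
      moreover have "X \<noteq> {}" "B' \<noteq> {}" using \<open>residue_count X \<ge> 2\<close> countB' B3 by auto
      ultimately show False
        using cauchy_davenport[OF \<open>periodic X\<close> \<open>periodic B'\<close>] countB' \<open>residue_count X \<ge> 2\<close> B3 bound
        by linarith
    qed
    then obtain e b c where e: "B \<inter> {x. x + e \<in> A} \<noteq> B" "b \<in> B \<inter> {x. x + e \<in> A}"
      "c \<in> B \<inter> {x. x + e \<in> A}" "\<not> int p dvd c - b" by blast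
    define A' where "A' = A \<union> {x. x + - e \<in> B}"
    define B' where "B' = B \<inter> {x. x + e \<in> A}"
    note e = e[folded B'_def]
    note T = dyson_transform[OF A(1) B(1), of e, folded A'_def B'_def]
    have "B' \<subseteq> B" by (auto simp: B'_def)
    then have B'_less: "residue_count B' < residue_count B"
      using subset_residue_count_eq[OF T(2) B(1)] e(1) not_le by blast
    have B'2: "2 \<le> residue_count B'" using pair[OF T(2) e(2,3,4)] residue_count_mono by metis
    have A'2: "2 \<le> residue_count A'" using A residue_count_mono[of A A'] by (auto simp: A'_def)
    have crit': "residue_count (A' + B') + 1 \<le> residue_count A' + residue_count B'"
      using residue_count_mono[OF T(3)] crit T(4) by simp
    have bound': "residue_count A' + residue_count B' + 1 \<le> p" using T(4) bound by simp
    obtain d a b where d: "\<not> int p dvd d" and AB': "A' = progression d a (residue_count A')"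
      "B' = progression d b (residue_count B')"
      using less.hyps[OF B'_less T(1,2) A'2 B'2 crit' bound'] by blast
    let ?n = "residue_count A' + residue_count B' - 1"
    have sum': "A' + B' = progression d (a + b) ?n"
      using progression_plus[of "residue_count A'" "residue_count B'" d a b] A'2 B'2
      unfolding AB'[symmetric] by linarith
    have n: "?n \<le> p" using bound T(4) by simp
    have "residue_count (A' + B') = ?n" unfolding sum' using residue_count_progression[OF d n] .
    \<comment> \<open>The sumset of the transform already has |A| + |B| - 1 residues, the most that
      \<open>crit\<close> allows for \<open>A + B\<close>, so the inclusion between the two is an
      equality.\<close>
    then have "residue_count (A + B) \<le> residue_count (A' + B')" using T(4) crit by linarith
    then have "A' + B' = A + B"
      by (rule subset_residue_count_eq[OF periodic_plus[OF T(1)] periodic_plus[OF A(1)] T(3)])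
    then have sum: "A + B = progression d (a + b) ?n" using sum' by simp
    have "?n + 1 \<le> residue_count A + residue_count B" using T(4) A by linarith
    from critical_sum_progression[OF d A B(1) B_ne sum n this bound] d show ?thesis by blast
  qed
qed

end


section \<open>The Dias da Silva--Hamidoune theorem\<close>

lemma sum_PiE_insert:
  assumes "i \<notin> I"
  shows "(\<Sum>f\<in>PiE (insert i I) A. F f) = (\<Sum>a\<in>A i. \<Sum>g\<in>PiE I A. F (g(i := a)))"
proof -
  have "(\<Sum>f\<in>PiE (insert i I) A. F f) = (\<Sum>(a, g)\<in>A i \<times> PiE I A. F (g(i := a)))"
    unfolding PiE_insert_eq
    by (subst sum.reindex[OF inj_combinator[OF assms]]) (simp add: o_def case_prod_unfold)
  then show ?thesis by (simp add: sum.cartesian_product)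
qed

text \<open>Vandermonde's convolution of binomial coefficients factors the matrix into a lower and
  an upper triangular one, both with unit diagonal.\<close>

lemma det_binomial:
  "det (mat r r (\<lambda>(i, j). int ((n + i) choose j))) = 1"
proof -
  define L where "L = mat r r (\<lambda>(i, l). int (i choose l))"
  define U where "U = mat r r (\<lambda>(l, j). if l \<le> j then int (n choose (j - l)) else 0)"
  have carrier: "L \<in> carrier_mat r r" "U \<in> carrier_mat r r" by (auto simp: L_def U_def)
  have "mat r r (\<lambda>(i, j). int ((n + i) choose j)) = L * U"
  proof (rule eq_matI)
    fix i j assume "i < dim_row (L * U)" "j < dim_col (L * U)"
    then have ij: "i < r" "j < r" by (auto simp: L_def U_def)
    have "(L * U) $$ (i, j) = (\<Sum>l<r. int (i choose l) * (if l \<le> j then int (n choose (j - l)) else 0))"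
      using ij by (simp add: L_def U_def scalar_prod_def atLeast0LessThan)
    also have "\<dots> = (\<Sum>l\<le>j. int (i choose l) * int (n choose (j - l)))"
      using ij by (intro sum.mono_neutral_cong_right) auto
    also have "\<dots> = int ((i + n) choose j)"
      unfolding of_nat_mult[symmetric] of_nat_sum[symmetric] by (simp only: vandermonde)
    finally show "mat r r (\<lambda>(i, j). int ((n + i) choose j)) $$ (i, j) = (L * U) $$ (i, j)"
      using ij by (simp add: add.commute)
  qed (auto simp: L_def U_def)
  moreover have "det L = 1"
    using det_lower_triangular[OF _ carrier(1)] by (simp add: L_def prod_list_diag_prod)
  moreover have "det U = 1"
    using det_upper_triangular[OF _ carrier(2)] by (simp add: U_def prod_list_diag_prod upper_triangular_def)
  ultimately show ?thesis by (simp add: det_mult[OF carrier])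
qed

context prime_modulus
begin

text \<open>These are the weights of the divided difference on the nodes \<open>A\<close>: summing
  against them extracts the coefficient of degree \<open>c\<close> from a polynomial of degree at
  most \<open>c\<close>, modulo \<open>p\<close>.\<close>

lemma dual_weights_exist:
  assumes "card A = Suc c" "\<And>x y. x \<in> A \<Longrightarrow> y \<in> A \<Longrightarrow> [x = y] (mod int p) \<Longrightarrow> x = y"
  shows "\<exists>w. (\<forall>j<c. [(\<Sum>a\<in>A. w a * a ^ j) = 0] (mod int p)) \<and> [(\<Sum>a\<in>A. w a * a ^ c) = 1] (mod int p)"
  using assms
proof (induction c arbitrary: A)
  case 0
  then obtain a where "A = {a}" by (auto simp: card_1_singleton_iff)
  then show ?case by (intro exI[of _ "\<lambda>_. 1"]) simp
next
  case (Suc c)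
  obtain b B where B: "A = insert b B" "b \<notin> B" "card B = Suc c"
    using Suc.prems(1) by (metis card_Suc_eq)
  have fin: "finite B" using B by (metis card.infinite nat.distinct(1))
  obtain w where w: "\<And>j. j < c \<Longrightarrow> [(\<Sum>a\<in>B. w a * a ^ j) = 0] (mod int p)"
    "[(\<Sum>a\<in>B. w a * a ^ c) = 1] (mod int p)"
    using Suc.IH[OF B(3)] Suc.prems(2) B(1) by blast
  have "\<exists>y. [(a - b) * y = 1] (mod int p)" if "a \<in> B" for a
  proof -
    have "\<not> int p dvd a - b" using Suc.prems(2)[of a b] that B by (auto simp: cong_iff_dvd_diff)
    then have "coprime (a - b) (int p)"
      using prime_imp_coprime[of "int p" "a - b"] prime_p by (simp add: coprime_commute)
    then show ?thesis using cong_solve_coprime_int by blast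
  qed
  then obtain v where v: "\<And>a. a \<in> B \<Longrightarrow> [(a - b) * v a = 1] (mod int p)" by metis
  \<comment> \<open>The old weights are divided by \<open>a - b\<close> modulo \<open>p\<close>, and
    the weight at the new node \<open>b\<close> is chosen to make the moment of order 0 vanish. The
    recurrence \<open>M_Suc\<close> then shifts the old moments up by one degree.\<close>
  define w' where "w' a = (if a = b then - (\<Sum>a\<in>B. w a * v a) else w a * v a)" for a
  define M where "M j = (\<Sum>a\<in>A. w' a * a ^ j)" for j
  have M0: "M 0 = 0"
  proof -
    have "(\<Sum>a\<in>B. w' a) = (\<Sum>a\<in>B. w a * v a)" using B by (intro sum.cong) (auto simp: w'_def)
    then show ?thesis using B fin by (simp add: M_def w'_def)
  qed
  have M_Suc: "[M (Suc j) = b * M j + (\<Sum>a\<in>B. w a * a ^ j)] (mod int p)" for j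
  proof -
    have "M (Suc j) - b * M j = (\<Sum>a\<in>A. w' a * a ^ j * (a - b))"
      by (simp add: M_def sum_distrib_left sum_subtractf[symmetric] algebra_simps)
    also have "\<dots> = (\<Sum>a\<in>B. w' a * a ^ j * (a - b))" using B fin by simp
    also have "\<dots> = (\<Sum>a\<in>B. w a * a ^ j * ((a - b) * v a))"
      using B by (intro sum.cong) (auto simp: w'_def)
    also have "[\<dots> = (\<Sum>a\<in>B. w a * a ^ j * 1)] (mod int p)"
      by (intro cong_sum cong_mult cong_refl v)
    finally show ?thesis by (simp add: cong_iff_dvd_diff algebra_simps)
  qed
  have low: "[M j = 0] (mod int p)" if "j \<le> c" for j
    using that
  proof (induction j)
    case (Suc j)
    have "[b * M j + (\<Sum>a\<in>B. w a * a ^ j) = b * 0 + 0] (mod int p)"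
      using Suc by (intro cong_add cong_mult w) auto
    then show ?case using M_Suc cong_trans by fastforce
  qed (simp add: M0)
  have "[b * M c + (\<Sum>a\<in>B. w a * a ^ c) = b * 0 + 1] (mod int p)"
    using low by (intro cong_add cong_mult w) auto
  then have "[M (Suc c) = 1] (mod int p)" using M_Suc cong_trans by fastforce
  then show ?case using low unfolding M_def by (intro exI[of _ w']) auto
qed

text \<open>
  Modulo \<open>p\<close>, summation against the product of the weights extracts from a polynomial of degree at
  most \<open>\<Sum>c\<^sub>i\<close> the coefficient of \<open>\<Prod>x\<^sub>i ^ c\<^sub>i\<close>.  For the polynomial \<open>\<Prod>x\<^sub>i ^ s\<^sub>i (\<Sum>x\<^sub>i)^n\<close> this is a
  multinomial coefficient, multiplied here by \<open>\<Prod>c\<^sub>i!\<close> so that it reads correctly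
  (as \<open>0\<close>) also when some \<open>s\<^sub>i > c\<^sub>i\<close>.
\<close>
lemma tensor_weights_power_sum:
  fixes w :: "'i \<Rightarrow> int \<Rightarrow> int" and c s :: "'i \<Rightarrow> nat"
  assumes "finite I"
    and low: "\<And>i j. i \<in> I \<Longrightarrow> j < c i \<Longrightarrow> [(\<Sum>a\<in>A i. w i a * a ^ j) = 0] (mod int p)"
    and top: "\<And>i. i \<in> I \<Longrightarrow> [(\<Sum>a\<in>A i. w i a * a ^ c i) = 1] (mod int p)"
  defines "T J n \<equiv> (\<Sum>f\<in>PiE J A. (\<Prod>i\<in>J. w i (f i) * f i ^ s i) * (\<Sum>i\<in>J. f i) ^ n)"
  shows "(n + sum s I < sum c I \<longrightarrow> [T I n = 0] (mod int p)) \<and>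
    (n + sum s I = sum c I \<longrightarrow>
      [T I n * (\<Prod>i\<in>I. fact (c i)) = fact n * (\<Prod>i\<in>I. fact (s i) * int (c i choose s i))] (mod int p))"
  using assms(1-3)
proof (induction I arbitrary: n rule: finite_induct)
  case empty
  then show ?case by (simp add: T_def)
next
  case (insert i I)
  define M where "M j = (\<Sum>a\<in>A i. w i a * a ^ j)" for j
  have M_low: "[M j = 0] (mod int p)" if "j < c i" for j using insert.prems(1) that by (simp add: M_def)
  have M_top: "[M (c i) = 1] (mod int p)" using insert.prems(2) by (simp add: M_def)
  have IH_low: "[T I m = 0] (mod int p)" if "m + sum s I < sum c I" for m
    using insert.IH insert.prems that by simp
  have IH_top: "[T I m * (\<Prod>i\<in>I. fact (c i)) = fact m * (\<Prod>i\<in>I. fact (s i) * int (c i choose s i))] (mod int p)"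
    if "m + sum s I = sum c I" for m
    using insert.IH insert.prems that by simp
  \<comment> \<open>Split off the coordinate \<open>i\<close> and expand the power of the sum by the
    binomial theorem; \<open>t\<close> is the exponent that goes to this coordinate.\<close>
  have rec: "T (insert i I) n = (\<Sum>t\<le>n. int (n choose t) * M (s i + t) * T I (n - t))"
  proof -
    have "T (insert i I) n = (\<Sum>a\<in>A i. \<Sum>g\<in>PiE I A.
        (w i a * a ^ s i) * (\<Prod>j\<in>I. w j (g j) * g j ^ s j) * (a + (\<Sum>j\<in>I. g j)) ^ n)"
      unfolding T_def sum_PiE_insert[OF insert.hyps(2)]
    proof (intro sum.cong refl)
      fix a g
      have "(\<Prod>j\<in>I. w j ((g(i := a)) j) * (g(i := a)) j ^ s j) = (\<Prod>j\<in>I. w j (g j) * g j ^ s j)"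
        using insert.hyps by (intro prod.cong) auto
      moreover have "(\<Sum>j\<in>I. (g(i := a)) j) = (\<Sum>j\<in>I. g j)"
        using insert.hyps by (intro sum.cong) auto
      ultimately show "(\<Prod>j\<in>insert i I. w j ((g(i := a)) j) * (g(i := a)) j ^ s j) *
          (\<Sum>j\<in>insert i I. (g(i := a)) j) ^ n =
        (w i a * a ^ s i) * (\<Prod>j\<in>I. w j (g j) * g j ^ s j) * (a + (\<Sum>j\<in>I. g j)) ^ n"
        using insert.hyps by simp
    qed
    also have "\<dots> = (\<Sum>a\<in>A i. \<Sum>g\<in>PiE I A. \<Sum>t\<le>n. int (n choose t) * (w i a * a ^ (s i + t)) *
        ((\<Prod>j\<in>I. w j (g j) * g j ^ s j) * (\<Sum>j\<in>I. g j) ^ (n - t)))"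
      by (simp add: binomial_ring sum_distrib_left power_add mult_ac)
    also have "\<dots> = (\<Sum>a\<in>A i. \<Sum>t\<le>n. \<Sum>g\<in>PiE I A. int (n choose t) * (w i a * a ^ (s i + t)) *
        ((\<Prod>j\<in>I. w j (g j) * g j ^ s j) * (\<Sum>j\<in>I. g j) ^ (n - t)))"
      by (intro sum.cong refl sum.swap)
    also have "\<dots> = (\<Sum>t\<le>n. \<Sum>a\<in>A i. \<Sum>g\<in>PiE I A. int (n choose t) * (w i a * a ^ (s i + t)) *
        ((\<Prod>j\<in>I. w j (g j) * g j ^ s j) * (\<Sum>j\<in>I. g j) ^ (n - t)))"
      by (rule sum.swap)
    also have "\<dots> = (\<Sum>t\<le>n. int (n choose t) * M (s i + t) * T I (n - t))"
    proof (intro sum.cong refl)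
      fix t
      have "int (n choose t) * M (s i + t) * T I (n - t) = int (n choose t) * (M (s i + t) * T I (n - t))"
        by simp
      also have "M (s i + t) * T I (n - t) = (\<Sum>a\<in>A i. \<Sum>g\<in>PiE I A. (w i a * a ^ (s i + t)) *
          ((\<Prod>j\<in>I. w j (g j) * g j ^ s j) * (\<Sum>j\<in>I. g j) ^ (n - t)))"
        unfolding M_def T_def by (rule sum_product)
      finally show "(\<Sum>a\<in>A i. \<Sum>g\<in>PiE I A. int (n choose t) * (w i a * a ^ (s i + t)) *
          ((\<Prod>j\<in>I. w j (g j) * g j ^ s j) * (\<Sum>j\<in>I. g j) ^ (n - t))) =
        int (n choose t) * M (s i + t) * T I (n - t)"
        by (simp add: sum_distrib_left mult.assoc)
    qed
    finally show ?thesis .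
  qed
  \<comment> \<open>If \<open>t\<close> is too small, the moment at \<open>i\<close> vanishes; if it
    is too large, the remaining coordinates have too little total degree.\<close>
  have vanish: "[int (n choose t) * M (s i + t) * T I (n - t) = 0] (mod int p)"
    if "t \<le> n" "s i + t < c i \<or> n - t + sum s I < sum c I" for t
    using that(2)
  proof
    assume "s i + t < c i"
    from cong_mult[OF cong_mult[OF cong_refl M_low[OF this]] cong_refl] show ?thesis by fastforce
  next
    assume "n - t + sum s I < sum c I"
    from cong_mult[OF cong_refl IH_low[OF this]] show ?thesis by fastforce
  qed
  show ?case
  proof (intro conjI impI)
    assume "n + sum s (insert i I) < sum c (insert i I)"
    then have "[T (insert i I) n = (\<Sum>t\<le>n. 0)] (mod int p)"
      unfolding rec using insert.hyps by (intro cong_sum vanish) auto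
    then show "[T (insert i I) n = 0] (mod int p)" by simp
  next
    assume n: "n + sum s (insert i I) = sum c (insert i I)"
    then have n': "n + s i + sum s I = c i + sum c I" using insert.hyps by simp
    let ?F = "\<Prod>j\<in>I. fact (c j) :: int" and ?R = "\<Prod>j\<in>I. fact (s j) * int (c j choose s j)"
    have "[T (insert i I) n * (fact (c i) * ?F) = fact n * ((fact (s i) * int (c i choose s i)) * ?R)] (mod int p)"
    \<comment> \<open>Only \<open>t = c i - s i\<close> can survive. When this is not an admissible
      exponent, the left side vanishes, and so does the right side: either \<open>s i > c i\<close>,
      or the degree balance forces \<open>s j > c j\<close> for some \<open>j\<close> in
      \<open>I\<close>, and a binomial coefficient is 0.\<close>
    proof (cases "s i \<le> c i \<and> c i - s i \<le> n")
      case False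
      have "[T (insert i I) n = (\<Sum>t\<le>n. 0)] (mod int p)"
        unfolding rec
      proof (intro cong_sum vanish)
        fix t assume "t \<in> {..n}"
        then show "s i + t < c i \<or> n - t + sum s I < sum c I" using False n' by auto
      qed simp
      then have T0: "[T (insert i I) n = 0] (mod int p)" by simp
      have "[T (insert i I) n * (fact (c i) * ?F) = 0 * (fact (c i) * ?F)] (mod int p)"
        by (rule cong_mult[OF T0 cong_refl])
      moreover have "[fact n * ((fact (s i) * int (c i choose s i)) * ?R) = 0] (mod int p)"
      proof (cases "s i \<le> c i")
        case True
        then have "sum c I < sum s I" using False n' by linarith
        then obtain j where "j \<in> I" "c j < s j" using sum_mono[of I s c] by (meson not_le)
        then have "?R = 0" using insert.hyps by (intro prod_zero) auto
        then show ?thesis by simp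
      qed (simp add: binomial_eq_0)
      ultimately show ?thesis by (simp add: cong_def)
    next
      case True
      define t where "t = c i - s i"
      have t: "t \<le> n" "s i + t = c i" "n - t + sum s I = sum c I" using True n' by (auto simp: t_def)
      have "[T (insert i I) n = (\<Sum>u\<le>n. if u = t then int (n choose t) * M (c i) * T I (n - t) else 0)] (mod int p)"
        unfolding rec
      proof (intro cong_sum)
        fix u assume u: "u \<in> {..n}"
        show "[int (n choose u) * M (s i + u) * T I (n - u) =
          (if u = t then int (n choose t) * M (c i) * T I (n - t) else 0)] (mod int p)"
        proof (cases "u = t")
          case True
          then show ?thesis by (simp add: t)
        next
          case False
          then have "s i + u < c i \<or> n - u + sum s I < sum c I" using u t by auto
          then show ?thesis using vanish u False by simp
        qed
      qed
      then have "[T (insert i I) n = int (n choose t) * M (c i) * T I (n - t)] (mod int p)" using t by simp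
      also have "[int (n choose t) * M (c i) * T I (n - t) = int (n choose t) * 1 * T I (n - t)] (mod int p)"
        by (intro cong_mult cong_refl M_top)
      finally have "[T (insert i I) n * (fact (c i) * ?F) = int (n choose t) * 1 * T I (n - t) * (fact (c i) * ?F)] (mod int p)"
        by (rule cong_mult[OF _ cong_refl])
      also have "int (n choose t) * 1 * T I (n - t) * (fact (c i) * ?F) =
          (int (n choose t) * fact (c i)) * (T I (n - t) * ?F)" by simp
      also have "[\<dots> = (int (n choose t) * fact (c i)) * (fact (n - t) * ?R)] (mod int p)"
        by (intro cong_mult cong_refl IH_top t)
      also have "(int (n choose t) * fact (c i)) * (fact (n - t) * ?R) =
          fact n * ((fact (s i) * int (c i choose s i)) * ?R)"
      proof -
        have 1: "fact t * fact (n - t) * int (n choose t) = fact n"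
          using binomial_fact_lemma[OF t(1)] by (metis of_nat_fact of_nat_mult)
        have "fact (s i) * fact (c i - s i) * int (c i choose s i) = fact (c i)"
          using binomial_fact_lemma[of "s i" "c i"] True by (metis of_nat_fact of_nat_mult)
        then have "fact (c i) = fact t * (fact (s i) * int (c i choose s i))" by (simp add: t_def mult_ac)
        then show ?thesis unfolding 1[symmetric] by simp
      qed
      finally show ?thesis .
    qed
    then show "[T (insert i I) n * (\<Prod>i\<in>insert i I. fact (c i)) =
        fact n * (\<Prod>i\<in>insert i I. fact (s i) * int (c i choose s i))] (mod int p)"
      using insert.hyps by simp
  qed
qed

text \<open>
  The polynomial method of Alon, Nathanson and Ruzsa.  If the sums lie in a set \<open>S\<close> with at most
  \<open>N = r(k - r)\<close> elements, then the Vandermonde determinant of \<open>x\<^sub>0,\<dots>,x\<^sub>r\<^sub>-\<^sub>1\<close> times \<open>g(\<Sum>x\<^sub>i)\<close>, with \<open>g\<close> monic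
  of degree \<open>N\<close> and divisible by \<open>\<Prod>\<^sub>s\<^sub>\<in>\<^sub>S (X - s)\<close>, vanishes on a product of subsets of \<open>A\<close> of sizes
  \<open>k - r + 1,\<dots>,k\<close>, while its coefficient at \<open>\<Prod>x\<^sub>i ^ (k - r + i)\<close> is nonzero modulo \<open>p\<close>.
\<close>
theorem dias_da_silva_hamidoune:
  fixes A S :: "int set"
  assumes inj: "\<And>x y. x \<in> A \<Longrightarrow> y \<in> A \<Longrightarrow> [x = y] (mod int p) \<Longrightarrow> x = y"
    and A: "finite A" "card A = k" and r: "r \<le> k" "r \<le> p" "r * (k - r) < p"
    and S: "finite S" "\<And>I. I \<subseteq> A \<Longrightarrow> card I = r \<Longrightarrow> \<exists>s\<in>S. [\<Sum>I = s] (mod int p)"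
  shows "r * (k - r) < card S"
proof (rule ccontr)
  define N where "N = r * (k - r)"
  assume "\<not> r * (k - r) < card S"
  then have S_le: "card S \<le> N" by (simp add: N_def)
  define c where "c i = k - r + i" for i
  have "\<exists>B. B \<subseteq> A \<and> card B = Suc (c i)" if "i \<in> {0..<r}" for i
  proof -
    have "Suc (c i) \<le> card A" using that r A by (auto simp: c_def)
    then show ?thesis by (meson obtain_subset_with_card_n)
  qed
  then obtain B where B: "\<And>i. i \<in> {0..<r} \<Longrightarrow> B i \<subseteq> A" "\<And>i. i \<in> {0..<r} \<Longrightarrow> card (B i) = Suc (c i)"
    by metis
  have "\<exists>w. (\<forall>j<c i. [(\<Sum>a\<in>B i. w a * a ^ j) = 0] (mod int p)) \<and>
      [(\<Sum>a\<in>B i. w a * a ^ c i) = 1] (mod int p)" if "i \<in> {0..<r}" for i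
    using dual_weights_exist[OF B(2)[OF that]] B(1)[OF that] inj by blast
  then obtain w where w: "\<And>i j. i \<in> {0..<r} \<Longrightarrow> j < c i \<Longrightarrow> [(\<Sum>a\<in>B i. w i a * a ^ j) = 0] (mod int p)"
    "\<And>i. i \<in> {0..<r} \<Longrightarrow> [(\<Sum>a\<in>B i. w i a * a ^ c i) = 1] (mod int p)" by metis
  \<comment> \<open>The monomial pads the degree to exactly \<open>N\<close>, so that the
    Vandermonde determinant times \<open>g\<close> of the sum has total degree
    \<open>sum c {0..<r}\<close>.\<close>
  define g where "g = (\<Prod>s\<in>S. [:- s, 1:]) * monom 1 (N - card S)"
  have deg: "degree (\<Prod>s\<in>S. [:- s, 1:]) = card S"
    by (simp add: degree_prod_eq_sum_degree)
  have lead: "lead_coeff (\<Prod>s\<in>S. [:- s, 1:]) = 1"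
    unfolding lead_coeff_prod by simp
  have g: "degree g = N" "coeff g N = 1"
  proof -
    have "lead_coeff g = 1" unfolding g_def lead_coeff_mult lead by (simp add: degree_monom_eq)
    moreover show "degree g = N"
      unfolding g_def using S_le deg lead by (subst degree_mult_eq) (auto simp: degree_monom_eq)
    ultimately show "coeff g N = 1" by simp
  qed
  define V where "V f = mat r r (\<lambda>(i, j). f i ^ j)" for f :: "nat \<Rightarrow> int"
  define E where "E = PiE {0..<r} B"
  define T where "T = (\<Sum>f\<in>E. (\<Prod>i=0..<r. w i (f i)) * det (V f) * poly g (\<Sum>i=0..<r. f i))"
  have "[T = (\<Sum>f\<in>E. 0)] (mod int p)"
    unfolding T_def
  proof (intro cong_sum)
    fix f assume "f \<in> E"
    then have fA: "f ` {0..<r} \<subseteq> A" using B(1) by (fastforce simp: E_def PiE_iff)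
    show "[(\<Prod>i=0..<r. w i (f i)) * det (V f) * poly g (\<Sum>i=0..<r. f i) = 0] (mod int p)"
    \<comment> \<open>Distinct entries have their sum congruent to a root of \<open>g\<close>; a
      repeated entry gives the Vandermonde matrix two equal rows.\<close>
    proof (cases "inj_on f {0..<r}")
      case True
      then have "card (f ` {0..<r}) = r" "\<Sum>(f ` {0..<r}) = (\<Sum>i=0..<r. f i)"
        by (simp_all add: card_image sum.reindex)
      then obtain s where s: "s \<in> S" "[(\<Sum>i=0..<r. f i) = s] (mod int p)" using S(2)[OF fA] by auto
      then have "int p dvd (\<Prod>s\<in>S. (\<Sum>i=0..<r. f i) - s)"
        using S(1) by (metis (no_types, lifting) cong_iff_dvd_diff dvd_trans dvd_prodI)
      then have "int p dvd poly g (\<Sum>i=0..<r. f i)" by (simp add: g_def poly_prod)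
      then show ?thesis by (simp add: cong_0_iff)
    next
      case False
      then obtain i j where "i < r" "j < r" "i \<noteq> j" "f i = f j" by (auto simp: inj_on_def)
      then have "det (V f) = 0"
        by (intro det_identical_rows[of _ r i j]) (auto simp: V_def)
      then show ?thesis by simp
    qed
  qed
  then have T0: "[T = 0] (mod int p)" by simp
  define U where "U \<sigma> n = (\<Sum>f\<in>E. (\<Prod>i\<in>{0..<r}. w i (f i) * f i ^ \<sigma> i) * (\<Sum>i\<in>{0..<r}. f i) ^ n)"
    for \<sigma> :: "nat \<Rightarrow> nat" and n
  let ?P = "{\<sigma>. \<sigma> permutes {0..<r}}"
  \<comment> \<open>The Leibniz formula for the determinant and the coefficients of \<open>g\<close>
    break \<open>T\<close> into sums of the shape treated in
    \<open>tensor_weights_power_sum\<close>, with exponents \<open>\<sigma> i\<close>.\<close>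
  have T_eq: "T = (\<Sum>\<sigma>\<in>?P. signof \<sigma> * (\<Sum>n\<le>N. coeff g n * U \<sigma> n))"
  proof -
    have "det (V f) = (\<Sum>\<sigma>\<in>?P. signof \<sigma> * (\<Prod>i=0..<r. f i ^ \<sigma> i))" for f
    proof -
      have "(\<Prod>i=0..<r. V f $$ (i, \<sigma> i)) = (\<Prod>i=0..<r. f i ^ \<sigma> i)" if "\<sigma> permutes {0..<r}" for \<sigma>
        using permutes_in_image[OF that] by (intro prod.cong) (auto simp: V_def)
      then show ?thesis by (subst det_def'[of _ r]) (auto simp: V_def intro!: sum.cong)
    qed
    then have "T = (\<Sum>f\<in>E. \<Sum>\<sigma>\<in>?P. \<Sum>n\<le>N. signof \<sigma> * (coeff g n *
        ((\<Prod>i=0..<r. w i (f i) * f i ^ \<sigma> i) * (\<Sum>i=0..<r. f i) ^ n)))"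
      unfolding T_def
      by (simp add: poly_altdef g sum_distrib_left sum_distrib_right prod.distrib mult_ac)
    also have "\<dots> = (\<Sum>\<sigma>\<in>?P. \<Sum>f\<in>E. \<Sum>n\<le>N. signof \<sigma> * (coeff g n *
        ((\<Prod>i=0..<r. w i (f i) * f i ^ \<sigma> i) * (\<Sum>i=0..<r. f i) ^ n)))"
      by (rule sum.swap)
    also have "\<dots> = (\<Sum>\<sigma>\<in>?P. \<Sum>n\<le>N. \<Sum>f\<in>E. signof \<sigma> * (coeff g n *
        ((\<Prod>i=0..<r. w i (f i) * f i ^ \<sigma> i) * (\<Sum>i=0..<r. f i) ^ n)))"
      by (intro sum.cong refl sum.swap)
    finally show ?thesis by (simp add: U_def sum_distrib_left)
  qed
  have degrees: "N + sum \<sigma> {0..<r} = sum c {0..<r}" if "\<sigma> permutes {0..<r}" for \<sigma>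
    using sum.permute[OF that, of id] by (simp add: N_def c_def sum.distrib o_def)
  define F where "F = (\<Prod>i\<in>{0..<r}. fact (c i) :: int)"
  define D where "D = (\<Prod>i\<in>{0..<r}. fact i :: int)"
  \<comment> \<open>Below degree \<open>N\<close> the total degree falls short, so only the leading
    coefficient of \<open>g\<close>, which is 1, contributes.\<close>
  have U_low: "[U \<sigma> n = 0] (mod int p)" if "\<sigma> permutes {0..<r}" "n < N" for \<sigma> n
    using tensor_weights_power_sum[where I = "{0..<r}" and n = n and s = \<sigma>, OF _ w] degrees[OF that(1)] that(2)
    unfolding U_def E_def by simp
  have U_top: "[U \<sigma> N * F = fact N * (D * (\<Prod>i=0..<r. int (c i choose \<sigma> i)))] (mod int p)"
    if "\<sigma> permutes {0..<r}" for \<sigma>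
  proof -
    have "(\<Prod>i=0..<r. fact (\<sigma> i) :: int) = D"
      using prod.permute[OF that, of "fact :: nat \<Rightarrow> int"] by (simp add: D_def o_def)
    then show ?thesis
      using tensor_weights_power_sum[where I = "{0..<r}" and n = N and s = \<sigma>, OF _ w] degrees[OF that]
      unfolding U_def E_def F_def by (simp add: prod.distrib)
  qed
  have "T * F = (\<Sum>\<sigma>\<in>?P. signof \<sigma> * ((\<Sum>n\<le>N. coeff g n * U \<sigma> n) * F))"
    unfolding T_eq sum_distrib_right[of _ ?P] mult.assoc ..
  also have "[\<dots> = (\<Sum>\<sigma>\<in>?P. signof \<sigma> * (fact N * (D * (\<Prod>i=0..<r. int (c i choose \<sigma> i)))))] (mod int p)"
  proof (rule cong_sum, rule cong_mult[OF cong_refl])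
    fix \<sigma> assume "\<sigma> \<in> ?P"
    then have \<sigma>: "\<sigma> permutes {0..<r}" by simp
    have "[(\<Sum>n\<le>N. coeff g n * U \<sigma> n) = (\<Sum>n\<le>N. if n = N then U \<sigma> N else 0)] (mod int p)"
    proof (intro cong_sum)
      fix n assume "n \<in> {..N}"
      then show "[coeff g n * U \<sigma> n = (if n = N then U \<sigma> N else 0)] (mod int p)"
        using cong_mult[OF cong_refl[of "coeff g n"] U_low[where n = n, OF \<sigma>]] g by auto
    qed
    then have "[(\<Sum>n\<le>N. coeff g n * U \<sigma> n) * F = U \<sigma> N * F] (mod int p)"
      by (intro cong_mult cong_refl) simp
    then show "[(\<Sum>n\<le>N. coeff g n * U \<sigma> n) * F =
        fact N * (D * (\<Prod>i=0..<r. int (c i choose \<sigma> i)))] (mod int p)"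
      using U_top[OF \<sigma>] cong_trans by blast
  qed
  \<comment> \<open>The signed sum over permutations is again a Leibniz expansion, now of the
    binomial determinant of \<open>det_binomial\<close>.\<close>
  also have "(\<Sum>\<sigma>\<in>?P. signof \<sigma> * (fact N * (D * (\<Prod>i=0..<r. int (c i choose \<sigma> i))))) =
      fact N * D * det (mat r r (\<lambda>(i, j). int (c i choose j)))"
  proof -
    have "(\<Prod>i=0..<r. mat r r (\<lambda>(i, j). int (c i choose j)) $$ (i, \<sigma> i)) = (\<Prod>i=0..<r. int (c i choose \<sigma> i))"
      if "\<sigma> permutes {0..<r}" for \<sigma>
      using permutes_in_image[OF that] by (intro prod.cong) auto
    then show ?thesis
      by (subst det_def'[of _ r]) (auto simp: sum_distrib_left mult_ac intro!: sum.cong)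
  qed
  also have "\<dots> = fact N * D" by (simp add: c_def det_binomial)
  finally have "[T * F = fact N * D] (mod int p)" .
  moreover have "[T * F = 0] (mod int p)" using cong_mult[OF T0 cong_refl, of F] by simp
  ultimately have "int p dvd fact N * D" by (meson cong_0_iff cong_sym cong_trans)
  \<comment> \<open>This covers every factor of \<open>fact N * D\<close>, as \<open>N < p\<close>
    and the factorials in \<open>D\<close> have arguments below \<open>r \<le> p\<close>.\<close>
  moreover have "\<not> int p dvd fact m" if "m < p" for m
    using that prime_dvd_fact_iff[OF prime_p, of m] by (metis int_dvd_int_iff not_le of_nat_fact)
  moreover have "prime (int p)" using prime_p by simp
  ultimately show False
    using r by (auto simp: D_def N_def prime_dvd_mult_iff prime_dvd_prod_iff)
qed


section \<open>Sums with repetitions\<close>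

text \<open>The multiplicities \<open>x\<close> are defined on all of \<open>A\<close> with 0
  allowed; their support takes the place of the index set \<open>I\<close> in
  \<open>distinct_sumset\<close>. Working up to congruence makes the set periodic.\<close>

definition repeated_sums :: "nat \<Rightarrow> nat \<Rightarrow> int set \<Rightarrow> int set" where
  "repeated_sums h r A = {z. \<exists>x. r \<le> card {a \<in> A. x a \<ge> 1} \<and> sum x A = h \<and>
    [z = (\<Sum>a\<in>A. int (x a) * a)] (mod int p)}"

lemma periodic_repeated_sums: "periodic (repeated_sums h r A)"
  unfolding periodic_def repeated_sums_def by (blast intro: cong_trans dest: cong_sym)

text \<open>Raising one multiplicity by 1 adds a summand and never lowers the number of distinct
  summands.\<close>

lemma repeated_sums_plus_subset:
  assumes "finite A"
  shows "repeated_sums h r A + {x. x mod int p \<in> A} \<subseteq> repeated_sums (Suc h) r A"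
proof
  fix z assume "z \<in> repeated_sums h r A + {x. x mod int p \<in> A}"
  then obtain u b where u: "z = u + b" "u \<in> repeated_sums h r A" "b mod int p \<in> A"
    by (auto elim!: set_plus_elim)
  define b' where "b' = b mod int p"
  from u(2) obtain x where x: "r \<le> card {a \<in> A. x a \<ge> 1}" "sum x A = h"
    "[u = (\<Sum>a\<in>A. int (x a) * a)] (mod int p)" by (auto simp: repeated_sums_def)
  define y where "y a = x a + (if a = b' then 1 else 0)" for a
  have b': "b' \<in> A" "[b = b'] (mod int p)" using u by (simp_all add: b'_def)
  have "card {a \<in> A. x a \<ge> 1} \<le> card {a \<in> A. y a \<ge> 1}"
    using assms by (intro card_mono) (auto simp: y_def)
  then have "r \<le> card {a \<in> A. y a \<ge> 1}" using x by simp
  moreover have "sum y A = Suc h" using assms b' x by (simp add: y_def sum.distrib)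
  moreover have "(\<Sum>a\<in>A. int (y a) * a) = (\<Sum>a\<in>A. int (x a) * a) + b'"
  proof -
    have "(\<Sum>a\<in>A. int (y a) * a) = (\<Sum>a\<in>A. int (x a) * a + (if a = b' then a else 0))"
      by (intro sum.cong) (auto simp: y_def algebra_simps)
    then show ?thesis using assms b' by (simp add: sum.distrib)
  qed
  then have "[z = (\<Sum>a\<in>A. int (y a) * a)] (mod int p)" using cong_add[OF x(3) b'(2)] u by simp
  ultimately show "z \<in> repeated_sums (Suc h) r A" unfolding repeated_sums_def by blast
qed

lemma subset_sum_in_repeated_sums:
  assumes "finite A" "I \<subseteq> A"
  shows "\<Sum>I \<in> repeated_sums (card I) (card I) A"
proof -
  let ?x = "\<lambda>a. if a \<in> I then 1 else 0 :: nat"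
  have "{a \<in> A. ?x a \<ge> 1} = I" "A \<inter> I = I" using assms by auto
  moreover have "sum ?x A = card (A \<inter> I)" using assms by (simp add: sum.If_cases)
  moreover have "(\<Sum>a\<in>A. int (?x a) * a) = \<Sum>(A \<inter> I)"
    using assms by (simp add: if_distrib[of "\<lambda>n. int n * _"] sum.inter_restrict cong: if_cong)
  ultimately show ?thesis unfolding repeated_sums_def by (intro CollectI exI[of _ ?x]) auto
qed

lemma residue_count_residues:
  assumes "A \<subseteq> {0..<int p}"
  shows "residue_count {x. x mod int p \<in> A} = card A"
proof -
  have "{x. x mod int p \<in> A} \<inter> {0..<int p} = A" using assms by auto
  then show ?thesis by (simp add: residue_count_def)
qed

text \<open>Induction on \<open>m\<close>: the base is the Dias da Silva--Hamidoune bound with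
  \<open>S\<close> the residues of \<open>repeated_sums r r A\<close>, and each further copy of
  \<open>A\<close> costs one use of Cauchy--Davenport. Since \<open>bound\<close> keeps the claimed
  value below \<open>p\<close>, the minimum there does no harm.\<close>

lemma residue_count_repeated_sums_ge:
  assumes A: "A \<subseteq> {0..<int p}" "A \<noteq> {}" and r: "r \<le> card A"
    and bound: "r * (card A - r) + m * (card A - 1) < p"
  shows "r * (card A - r) + m * (card A - 1) < residue_count (repeated_sums (r + m) r A)"
  using bound
proof (induction m)
  case 0
  have fin: "finite A" using A finite_subset by blast
  have "r \<le> p" using r card_mono[OF _ A(1)] by simp
  have "r * (card A - r) < card (repeated_sums r r A \<inter> {0..<int p})"
  proof (rule dias_da_silva_hamidoune[OF _ fin refl r \<open>r \<le> p\<close>])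
    fix x y assume "x \<in> A" "y \<in> A" "[x = y] (mod int p)"
    moreover from this have "x \<in> {0..<int p}" "y \<in> {0..<int p}" using A(1) by blast+
    ultimately show "x = y" by (simp add: cong_def)
  next
    fix I assume "I \<subseteq> A" "card I = r"
    then have "\<Sum>I mod int p \<in> repeated_sums r r A \<inter> {0..<int p}"
      using subset_sum_in_repeated_sums[OF fin] p_gt_1 periodic_mod_iff[OF periodic_repeated_sums] by auto
    then show "\<exists>s\<in>repeated_sums r r A \<inter> {0..<int p}. [\<Sum>I = s] (mod int p)"
      by (intro bexI[of _ "\<Sum>I mod int p"]) simp_all
  qed (use 0 in simp_all)
  then show ?case by (simp add: residue_count_def)
next
  case (Suc m)
  have fin: "finite A" using A finite_subset by blast
  let ?A = "{x. x mod int p \<in> A}" and ?E = "repeated_sums (r + m) r A"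
  have IH: "r * (card A - r) + m * (card A - 1) < residue_count ?E" using Suc by simp
  have "periodic ?A" by (auto simp: periodic_def cong_def)
  moreover have "card A > 0" using A fin by (simp add: card_gt_0_iff)
  then have "?A \<noteq> {}" "?E \<noteq> {}" using IH residue_count_residues[OF A(1)] by force+
  ultimately have "min p (residue_count ?E + card A - 1) \<le> residue_count (?E + ?A)"
    using cauchy_davenport[OF periodic_repeated_sums] residue_count_residues[OF A(1)] by metis
  also have "\<dots> \<le> residue_count (repeated_sums (r + Suc m) r A)"
    using residue_count_mono[OF repeated_sums_plus_subset[OF fin]] by simp
  finally have step: "min p (residue_count ?E + card A - 1) \<le> residue_count (repeated_sums (r + Suc m) r A)" .
  have "Suc m * (card A - 1) = m * (card A - 1) + (card A - 1)" by simp
  then show ?case using step IH Suc.prems \<open>card A > 0\<close> by linarith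
qed

end

section \<open>Transfer to the additive group of \<open>residue_ring\<close>\<close>

context residues
begin

lemma finsum_residues: "finite I \<Longrightarrow> f \<in> I \<rightarrow> carrier R \<Longrightarrow> finsum R f I = (\<Sum>i\<in>I. f i) mod m"
proof (induction I rule: finite_induct)
  case empty
  then show ?case by (simp add: res_zero_eq)
next
  case (insert i I)
  then show ?case by (simp add: finsum_insert Pi_iff res_add_eq mod_add_right_eq)
qed

lemma add_pow_residues: "a \<in> carrier R \<Longrightarrow> [n] \<cdot> a = (int n * a) mod m" for n :: nat
  by (induction n) (simp_all add: res_zero_eq res_add_eq mod_add_left_eq mod_add_right_eq algebra_simps)

end

context prime_modulus
begin

lemma residues_p: "residues (int p)"
  using p_gt_1 by (simp add: residues_def)

text \<open>Turns the assumed cardinality of \<open>distinct_sumset\<close> into an upper bound for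
  \<open>repeated_sums\<close>; the index set is the support of the multiplicities.\<close>

lemma repeated_sums_subset_distinct_sumset:
  assumes "A \<subseteq> {0..<int p}"
  shows "repeated_sums h r A \<inter> {0..<int p} \<subseteq> distinct_sumset (residue_ring (int p)) h r A"
proof
  interpret R: residues "int p" "residue_ring (int p)" by (rule residues_p) simp
  fix z assume z: "z \<in> repeated_sums h r A \<inter> {0..<int p}"
  then obtain x where x: "r \<le> card {a \<in> A. x a \<ge> 1}" "sum x A = h"
    "[z = (\<Sum>a\<in>A. int (x a) * a)] (mod int p)" by (auto simp: repeated_sums_def)
  define I where "I = {a \<in> A. x a \<ge> 1}"
  have fin: "finite A" using assms finite_subset by blast
  have carrier: "a \<in> carrier (residue_ring (int p))" if "a \<in> I" for a
    using that assms by (auto simp: I_def R.res_carrier_eq)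
  have "sum x I = h" unfolding x(2)[symmetric] using fin by (intro sum.mono_neutral_left) (auto simp: I_def)
  moreover have "(\<Sum>a\<in>I. int (x a) * a) = (\<Sum>a\<in>A. int (x a) * a)"
    using fin by (intro sum.mono_neutral_left) (auto simp: I_def)
  then have "z = (\<Sum>a\<in>I. int (x a) * a) mod int p" using x(3) z by (simp add: cong_def)
  moreover have "finsum (residue_ring (int p)) (\<lambda>a. [x a] \<cdot>\<^bsub>residue_ring (int p)\<^esub> a) I =
      (\<Sum>a\<in>I. int (x a) * a) mod int p"
  proof -
    have "finsum (residue_ring (int p)) (\<lambda>a. [x a] \<cdot>\<^bsub>residue_ring (int p)\<^esub> a) I =
        (\<Sum>a\<in>I. [x a] \<cdot>\<^bsub>residue_ring (int p)\<^esub> a) mod int p"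
      using fin carrier by (intro R.finsum_residues) (auto simp: I_def)
    also have "\<dots> = (\<Sum>a\<in>I. (int (x a) * a) mod int p) mod int p"
      using carrier by (simp add: R.add_pow_residues)
    finally show ?thesis by (simp add: mod_sum_eq)
  qed
  ultimately show "z \<in> distinct_sumset (residue_ring (int p)) h r A"
    unfolding distinct_sumset_def using x(1) by (intro CollectI exI[of _ I] exI[of _ x]) (auto simp: I_def)
qed

lemma finite_distinct_sumset: "finite (distinct_sumset (residue_ring (int p)) h r A)"
  if "A \<subseteq> carrier (residue_ring (int p))"
proof -
  interpret R: residues "int p" "residue_ring (int p)" by (rule residues_p) simp
  have "distinct_sumset (residue_ring (int p)) h r A \<subseteq> carrier (residue_ring (int p))"
    using that by (auto simp: distinct_sumset_def intro!: R.finsum_closed)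
  then show ?thesis by (rule finite_subset) simp
qed

lemma arith_progression_if_progression:
  assumes "A \<subseteq> {0..<int p}" "{x. x mod int p \<in> A} = progression d a (card A)"
  shows "arith_progression (residue_ring (int p)) A"
proof -
  interpret R: residues "int p" "residue_ring (int p)" by (rule residues_p) simp
  have carrier: "a mod int p \<in> carrier (residue_ring (int p))" "d mod int p \<in> carrier (residue_ring (int p))"
    using R.mod_in_carrier by auto
  have terms: "a mod int p \<oplus>\<^bsub>residue_ring (int p)\<^esub> [i] \<cdot>\<^bsub>residue_ring (int p)\<^esub> (d mod int p) =
      (a + int i * d) mod int p" for i
    using carrier by (simp add: R.add_pow_residues R.res_add_eq mod_simps)
  have "x \<in> A \<longleftrightarrow> (\<exists>i<card A. x = (a + int i * d) mod int p)" for x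
  proof -
    have "x \<in> A \<longleftrightarrow> x \<in> {0..<int p} \<and> x mod int p \<in> A" using assms(1) by auto
    also have "\<dots> \<longleftrightarrow> x \<in> {0..<int p} \<and> x \<in> progression d a (card A)" unfolding assms(2)[symmetric] by simp
    also have "\<dots> \<longleftrightarrow> (\<exists>i<card A. x = (a + int i * d) mod int p)"
      using p_gt_1 by (auto simp: progression_def cong_def)
    finally show ?thesis .
  qed
  then have "A = {a mod int p \<oplus>\<^bsub>residue_ring (int p)\<^esub> [i] \<cdot>\<^bsub>residue_ring (int p)\<^esub> (d mod int p) | i. i < card A}"
    unfolding terms by blast
  then show ?thesis unfolding arith_progression_def using carrier by blast
qed

end

theorem theorem3p4:
  fixes p k r h :: nat and A :: "int set"
  assumes "prime p"
    and "k \<ge> 2" and "r \<ge> 1" and "r \<le> k" and "h \<ge> r + 2"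
    and "A \<subseteq> carrier (residue_ring (int p))" and "card A = k"
    and "int (card (distinct_sumset (residue_ring (int p)) h r A))
           = int h * (int k - 1) - int r * (int r - 1) + 1"
    and "int h * (int k - 1) - int r * (int r - 1) + 1 \<le> int p - 2"
  shows "arith_progression (residue_ring (int p)) A"
proof -
  interpret prime_modulus p by unfold_locales fact
  have A: "A \<subseteq> {0..<int p}" using assms(6) by (auto simp: residue_ring_def)
  have fin: "finite A" using A finite_subset by blast
  have ne: "A \<noteq> {}" using assms(2,7) by auto
  \<comment> \<open>One copy of \<open>A\<close> is set aside: \<open>X\<close> below uses
    \<open>h - 1 = r + m\<close> summands, and \<open>X + A'\<close> lies in the set of sums of
    \<open>h\<close> summands.\<close>
  define m where "m = h - r - 1"
  have m: "h = Suc (r + m)" "m \<ge> 1" using assms(5) by (auto simp: m_def)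
  define X where "X = repeated_sums (r + m) r A"
  define A' where "A' = {x. x mod int p \<in> A}"
  \<comment> \<open>The extremal value rewritten as r(k - r) + (h - r)(k - 1) + 1, the form in which
    the lower bounds accumulate.\<close>
  define v where "v = r * (k - r) + m * (k - 1) + k"
  have "int h * (int k - 1) - int r * (int r - 1) + 1 = int v"
  proof -
    have "int (k - r) = int k - int r" "int (k - 1) = int k - 1" using assms(2,4) by simp_all
    then show ?thesis
      unfolding v_def m(1) of_nat_add of_nat_mult of_nat_Suc by (simp add: algebra_simps)
  qed
  then have v: "card (distinct_sumset (residue_ring (int p)) h r A) = v" "v + 2 \<le> p"
    using assms(8,9) by linarith+
  have "periodic X" unfolding X_def by (rule periodic_repeated_sums)
  have "periodic A'" by (auto simp: A'_def periodic_def cong_def)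
  have countA: "residue_count A' = k" unfolding A'_def residue_count_residues[OF A] by (rule assms(7))
  have countX: "v + 1 \<le> residue_count X + k"
    using residue_count_repeated_sums_ge[OF A ne, of r m] assms(4,7) v by (simp add: v_def X_def)
  \<comment> \<open>This is where \<open>h \<ge> r + 2\<close> enters: with \<open>m \<ge> 1\<close>
    the set \<open>X\<close> has the two residues that Vosper's theorem requires.\<close>
  have "1 * 1 \<le> m * (k - 1)" using m(2) assms(2) by (intro mult_mono) auto
  then have X2: "2 \<le> residue_count X" using countX unfolding v_def by linarith
  have "residue_count (X + A') \<le> residue_count (repeated_sums h r A)"
    unfolding X_def A'_def m(1) by (intro residue_count_mono repeated_sums_plus_subset fin)
  also have "\<dots> \<le> v"
    unfolding residue_count_def v(1)[symmetric]
    by (intro card_mono finite_distinct_sumset assms(6) repeated_sums_subset_distinct_sumset A)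
  finally have sum: "residue_count (X + A') \<le> v" .
  have "X \<noteq> {}" "A' \<noteq> {}" using X2 countA assms(2) by auto
  \<comment> \<open>As \<open>X + A'\<close> has at most \<open>v \<le> p - 2\<close> residues,
    Cauchy--Davenport gives |X| + k - 1 \<le> p - 2, the size condition of Vosper's theorem.\<close>
  then have "residue_count X + k + 1 \<le> p"
    using cauchy_davenport[OF \<open>periodic X\<close> \<open>periodic A'\<close>] sum v(2) countA assms(2) by simp
  then obtain d a where "A' = progression d a (card A)"
    using vosper[OF \<open>periodic X\<close> \<open>periodic A'\<close> X2] sum countX countA assms(2,7) by force
  then show ?thesis unfolding A'_def by (rule arith_progression_if_progression[OF A])
qed

end
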